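(* Let $q$ be a prime power with $q\equiv 1\pmod 3$ and $q\neq 4$. Let $\beta_0\in\mathbb{F}_q$ be such that $\beta_0^3-1$ is not a cube in $\mathbb{F}_q$, and let $(\beta_n)_{n\ge 0}$ be a sequence in a fixed algebraic closure $\overline{\mathbb{F}}_q$, starting at this $\beta_0$, such that for every $n\ge 1$, $g(\beta_{n-1},\beta_n)=0$, where $$g(X,Y)=Y^3+(6-9X^3)Y^2+(12-9X^3)Y+(8-9X^3).$$ For each $n$ put $\gamma_n:=\beta_n^3-1$. Then for every $n\ge 1$, $\gamma_n$ has degree $3^n$ over $\mathbb{F}_q$, and the multiplicative order of $\gamma_n$ in $\mathbb{F}_{q^{3^n}}^*$ is greater than $3^{\frac12 n^2+\frac32 n+\mathrm{ord}_3(q-1)}$.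
   Context: $\mathbb{F}_q$ is the finite field with $q$ elements, and $\mathbb{F}_{q^{k}}$ denotes its unique degree-$k$ extension inside the fixed algebraic closure $\overline{\mathbb{F}}_q$. For a prime $\ell$ and nonzero integer $a$, $\mathrm{ord}_\ell(a)$ is the exponent of the highest power of $\ell$ dividing $a$. Exponentiation is right-associative: $a^{b^c}=a^{(b^c)}$. The sequence $(\beta_n)$ is formed by choosing, at each step, any root $\beta_n\in\overline{\mathbb{F}}_q$ of the polynomial $g(\beta_{n-1},Y)$. An element is called a cube in $\mathbb{F}_q$ if it equals $y^3$ for some $y\in\mathbb{F}_q$ (so $0$ is a cube). *)

theory Defs
  imports "HOL-Algebra.Algebra" "HOL-Algebra.Algebraic_Closure_Type" "HOL-Library.Cardinality"
begin

text \<open>The ground field \<open>F\<^sub>q\<close> is a finite field type \<open>'a\<close>, with \<open>q = CARD('a)\<close>; its fixed algebraic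
  closure is \<open>'a alg_closure\<close>, in which \<open>F\<^sub>q\<close> is embedded by \<^const>\<open>to_ac\<close>.\<close>

abbreviation closure_ring :: "'a :: field alg_closure ring"
  where "closure_ring \<equiv> ring_of_type_algebra"

abbreviation ground_field :: "'a :: field alg_closure set"
  where "ground_field \<equiv> range to_ac"

definition degree_over_ground :: "'a :: field alg_closure \<Rightarrow> nat"
  where "degree_over_ground x = Polynomials.degree (ring.Irr closure_ring ground_field x)"

definition is_extension_of_degree :: "nat \<Rightarrow> 'a :: field alg_closure set \<Rightarrow> bool"
  where "is_extension_of_degree k E \<longleftrightarrow>
    subfield E closure_ring \<and> ground_field \<subseteq> E \<and> ring.dimension closure_ring k ground_field E"

text \<open>The definite description is justified, for finite ground fields and \<open>k > 0\<close>, by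
  \<open>ex1_extension_of_degree\<close> below.\<close>

definition extension_field :: "nat \<Rightarrow> 'a :: field alg_closure set"
  where "extension_field k = (THE E. is_extension_of_degree k E)"

definition extension_units :: "nat \<Rightarrow> 'a :: field alg_closure monoid"
  where "extension_units k = mult_of (closure_ring \<lparr>carrier := extension_field k\<rparr>)"

definition g :: "'r :: comm_ring_1 \<Rightarrow> 'r \<Rightarrow> 'r"
  where "g x y = y ^ 3 + (6 - 9 * x ^ 3) * y ^ 2 + (12 - 9 * x ^ 3) * y + (8 - 9 * x ^ 3)"


subsection \<open>Existence and uniqueness of the extension of degree \<open>k\<close>\<close>

lemma closure_ring_simps [simp]:
  "carrier closure_ring = UNIV" "\<zero>\<^bsub>closure_ring\<^esub> = 0" "\<one>\<^bsub>closure_ring\<^esub> = 1"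
  "x \<oplus>\<^bsub>closure_ring\<^esub> y = x + y" "x \<otimes>\<^bsub>closure_ring\<^esub> y = x * y"
  by (simp_all add: ring_of_type_algebra_def)

context
begin

interpretation closure: ring "closure_ring :: 'a :: field alg_closure ring"
  by (rule ring_from_type_algebra)

lemma closure_a_inv [simp]: "\<ominus>\<^bsub>closure_ring\<^esub> x = - (x :: 'a :: field alg_closure)"
  by (rule closure.minus_equality) auto

lemma closure_m_inv [simp]:
  "(x :: 'a :: field alg_closure) \<noteq> 0 \<Longrightarrow> inv\<^bsub>closure_ring\<^esub> x = inverse x"
  by (rule closure.inv_char) (auto simp: field_simps)

lemma subfield_closureI:
  fixes E :: "'a :: field alg_closure set"
  assumes "1 \<in> E" "\<And>x. x \<in> E \<Longrightarrow> - x \<in> E" "\<And>x y. x \<in> E \<Longrightarrow> y \<in> E \<Longrightarrow> x + y \<in> E"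
    "\<And>x y. x \<in> E \<Longrightarrow> y \<in> E \<Longrightarrow> x * y \<in> E" "\<And>x. x \<in> E \<Longrightarrow> inverse x \<in> E"
  shows "subfield E closure_ring"
  by (rule field.subfieldI'[OF field_from_type_algebra], rule closure.subringI) (use assms in auto)

lemma subfield_closureD:
  fixes E :: "'a :: field alg_closure set"
  assumes "subfield E closure_ring"
  shows "1 \<in> E" "0 \<in> E" "\<And>x. x \<in> E \<Longrightarrow> - x \<in> E" "\<And>x y. x \<in> E \<Longrightarrow> y \<in> E \<Longrightarrow> x + y \<in> E"
    "\<And>x y. x \<in> E \<Longrightarrow> y \<in> E \<Longrightarrow> x * y \<in> E" "\<And>x. x \<in> E \<Longrightarrow> x \<noteq> 0 \<Longrightarrow> inverse x \<in> E"
  using subringE[OF subfieldE(1)[OF assms]] closure.subfield_m_inv(1)[OF assms]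
  by auto

lemma subfield_ground_field: "subfield ground_field (closure_ring :: 'a :: field alg_closure ring)"
proof (rule subfield_closureI)
  show "1 \<in> (ground_field :: 'a alg_closure set)" by (metis rangeI to_ac_1)
qed (auto simp flip: to_ac_minus to_ac_add to_ac_mult to_ac_inverse)

lemma card_ground_field: "card (ground_field :: 'a :: field alg_closure set) = CARD('a)"
  by (rule card_image) (rule inj_to_ac)

lemma card_of_dimension:
  fixes E :: "'a :: finite_field alg_closure set"
  assumes "ring.dimension closure_ring n ground_field E"
  shows "finite E \<and> card E = CARD('a) ^ n"
proof -
  have "K = ground_field \<Longrightarrow> ?thesis" if "ring.dimension closure_ring n K E" for K
    using that
  proof (induction rule: ring.dimension.induct[OF ring_from_type_algebra, consumes 1, case_names zero_dim Suc_dim])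
    case zero_dim
    then show ?case by simp
  next
    case (Suc_dim v E n K)
    let ?K = "ground_field :: 'a alg_closure set"
    have sub: "0 \<in> E" "\<And>x y. x \<in> E \<Longrightarrow> y \<in> E \<Longrightarrow> x + y \<in> E"
      "\<And>c x. c \<in> ?K \<Longrightarrow> x \<in> E \<Longrightarrow> c * x \<in> E" "\<And>x. x \<in> E \<Longrightarrow> - x \<in> E"
      using closure.space_subgroup_props[OF subfield_ground_field Suc_dim(3)[unfolded Suc_dim(5)]] by auto
    have eq: "ring.line_extension closure_ring ?K v E = (\<lambda>(c, e). c * v + e) ` (?K \<times> E)"
      by (force simp: closure.line_extension_def set_add_def set_mult_def r_coset_def)
    have inj: "inj_on (\<lambda>(c, e). c * v + e) (?K \<times> E)"
    proof (rule inj_onI)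
      fix s t assume "s \<in> ?K \<times> E" "t \<in> ?K \<times> E"
        and *: "(\<lambda>(c, e). c * v + e) s = (\<lambda>(c, e). c * v + e) t"
      then obtain a e b f where st: "s = (to_ac a, e)" "t = (to_ac b, f)" "e \<in> E" "f \<in> E" by auto
      show "s = t"
      proof (cases "a = b")
        case False
        have "to_ac (a - b) * v = f - e"
          using * st by (simp add: algebra_simps)
        moreover have "f - e \<in> E"
          using sub(2)[OF st(4) sub(4)[OF st(3)]] by simp
        ultimately have "to_ac (inverse (a - b)) * (to_ac (a - b) * v) \<in> E"
          by (metis sub(3) rangeI)
        moreover have "to_ac (inverse (a - b)) * (to_ac (a - b) * v) = v"
          using False by simp
        ultimately show ?thesis using Suc_dim(2) by argo
      qed (use * st in auto)
    qed
    show ?case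
      unfolding Suc_dim(5) eq using Suc_dim by (auto simp: card_image[OF inj] card_ground_field card_cartesian_product)
  qed
  with assms show ?thesis by blast
qed

lemma power_card_subfield:
  fixes E :: "'a :: field alg_closure set"
  assumes E: "subfield E closure_ring" and fin: "finite E" and x: "x \<in> E"
  shows "x ^ card E = x"
proof (cases "x = 0")
  case True
  moreover have "card E > 0" using fin x by (auto simp: card_gt_0_iff)
  ultimately show ?thesis by simp
next
  case False
  note D = subfield_closureD[OF E]
  have "bij_betw (\<lambda>y. x * y) (E - {0}) (E - {0})"
    by (rule bij_betwI[where g = "\<lambda>y. inverse x * y"]) (use False x D in auto)
  then have "(\<Prod>y\<in>E - {0}. x * y) = \<Prod>(E - {0})"
    by (rule prod.reindex_bij_betw[where g = "\<lambda>y. y"])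
  then have "x ^ card (E - {0}) * \<Prod>(E - {0}) = \<Prod>(E - {0})"
    by (simp add: prod.distrib)
  moreover have "\<Prod>(E - {0}) \<noteq> 0" using fin by simp
  ultimately have "x ^ card (E - {0}) = 1" by simp
  moreover have "card E = Suc (card (E - {0}))"
    using fin D by (metis card_Suc_Diff1)
  ultimately show ?thesis by simp
qed

lemma CARD_finite_field_gt_1: "CARD('a :: finite_field) > 1"
proof -
  have "card {0, 1 :: 'a} \<le> CARD('a)" by (rule card_mono) auto
  then show ?thesis by simp
qed

lemma of_nat_CARD_eq_0: "of_nat CARD('a :: finite_field) = (0 :: 'a alg_closure)"
proof -
  have "(\<Sum>x\<in>UNIV. x + 1) = (\<Sum>x\<in>UNIV. x :: 'a)"
    by (rule sum.reindex_bij_witness[of _ "\<lambda>x. x - 1" "\<lambda>x. x + 1"]) auto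
  then have "of_nat CARD('a) = (0 :: 'a)" by (simp add: sum.distrib)
  then show ?thesis by (metis to_ac_0 to_ac_of_nat)
qed

lemma of_nat_CARD_choose_eq_0:
  assumes "0 < i" "i < CARD('a :: finite_field)"
  shows "of_nat (CARD('a) choose i) = (0 :: 'a)"
proof -
  let ?q = "CARD('a)"
  define p :: "'a poly" where "p = (\<Sum>i\<in>{0<..<?q}. Polynomial.monom (of_nat (?q choose i)) i)"
  have "poly p x = 0" for x
  proof -
    have eq: "{..?q} = insert 0 (insert ?q {0<..<?q})"
      using CARD_finite_field_gt_1[where ?'a = 'a] by auto
    have "(x + 1) ^ ?q = 1 + x ^ ?q + poly p x"
      unfolding binomial_ring[of x 1] eq p_def
      using CARD_finite_field_gt_1[where ?'a = 'a] by (simp add: poly_sum poly_monom)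
    then show ?thesis
      by (simp add: finite_field_power_card_eq_same)
  qed
  then have "card {x. poly p x = 0} = ?q" by simp
  moreover have "Polynomial.degree p < ?q"
    unfolding p_def using CARD_finite_field_gt_1[where ?'a = 'a]
    by (intro degree_sum_less) (auto intro: le_less_trans[OF degree_monom_le])
  ultimately have "p = 0" using card_poly_roots_bound[of p] by fastforce
  then have "Polynomial.coeff p i = 0" by simp
  then show ?thesis using assms by (simp add: p_def Polynomial.coeff_sum)
qed

lemma power_CARD_add:
  fixes x y :: "'a :: finite_field alg_closure"
  shows "(x + y) ^ (CARD('a) ^ k) = x ^ (CARD('a) ^ k) + y ^ (CARD('a) ^ k)"
proof (induction k)
  case (Suc k)
  let ?q = "CARD('a)"
  have *: "(u + v) ^ ?q = u ^ ?q + v ^ ?q" for u v :: "'a alg_closure"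
  proof -
    have eq: "{..?q} = insert 0 (insert ?q {0<..<?q})"
      using CARD_finite_field_gt_1[where ?'a = 'a] by auto
    have "of_nat (?q choose i) = (0 :: 'a alg_closure)" if "i \<in> {0<..<?q}" for i
      using of_nat_CARD_choose_eq_0[where ?'a = 'a, of i] that by (metis greaterThanLessThan_iff to_ac_0 to_ac_of_nat)
    then show ?thesis
      unfolding binomial_ring[of u v] eq
      using CARD_finite_field_gt_1[where ?'a = 'a] by simp
  qed
  show ?case
    by (simp only: power_Suc2 power_mult Suc.IH *)
qed auto

lemma card_roots_eq_degree:
  fixes p :: "'a :: alg_closed_field poly"
  assumes "p \<noteq> 0" and simple: "\<And>x. poly p x = 0 \<Longrightarrow> poly (pderiv p) x \<noteq> 0"
  shows "card {x. poly p x = 0} = Polynomial.degree p"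
proof -
  obtain A where A: "size A = Polynomial.degree p"
    "p = smult (Polynomial.lead_coeff p) (\<Prod>x\<in>#A. [:-x, 1:])"
    using alg_closed_imp_factorization[OF assms(1)] by blast
  have "poly p x = Polynomial.lead_coeff p * (\<Prod>y\<in>#A. x - y)" for x
    by (rule trans[OF arg_cong[where f = "\<lambda>p. poly p x", OF A(2)]]) (simp add: poly_prod_mset)
  then have roots: "{x. poly p x = 0} = set_mset A"
    using assms(1) by auto
  have "count A x = 1" if "x \<in># A" for x
  proof (rule ccontr)
    assume "count A x \<noteq> 1"
    moreover from that obtain A' where A': "A = add_mset x A'"
      by (blast dest: multi_member_split)
    ultimately have "x \<in># A'" by (auto simp: not_in_iff)
    then obtain B where B: "A = add_mset x (add_mset x B)"
      using A' by (blast dest: multi_member_split)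
    define r where "r = smult (Polynomial.lead_coeff p) (\<Prod>x\<in>#B. [:-x, 1:])"
    have "p = [:-x, 1:] * ([:-x, 1:] * r)"
      by (rule trans[OF A(2)]) (simp only: B r_def image_mset_add_mset prod_mset.add_mset mult_smult_right)
    then obtain u where u: "p = [:-x, 1:] * u" "u = [:-x, 1:] * r" by blast
    have "poly u x = 0" unfolding u(2) by simp
    then have "poly p x = 0" "poly (pderiv p) x = 0"
      by (simp_all only: u(1) pderiv_mult) simp_all
    with simple show False by blast
  qed
  then have "size A = card (set_mset A)"
    by (simp add: size_multiset_overloaded_eq)
  with A(1) roots show ?thesis by simp
qed

lemma is_extension_of_degree_iff:
  fixes E :: "'a :: finite_field alg_closure set"
  assumes "k > 0"
  shows "is_extension_of_degree k E \<longleftrightarrow> E = {x. x ^ (CARD('a) ^ k) = x}"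
proof -
  let ?N = "CARD('a) ^ k" and ?K = "ground_field :: 'a alg_closure set"
  define R where "R = {x :: 'a alg_closure. x ^ ?N = x}"
  have N: "?N > 1" using CARD_finite_field_gt_1[where ?'a = 'a] assms by (rule one_less_power)
  have card_R: "card R = ?N"
  proof -
    define p :: "'a alg_closure poly" where "p = Polynomial.monom 1 ?N - Polynomial.monom 1 1"
    have deg: "Polynomial.degree p = ?N"
      unfolding p_def diff_conv_add_uminus using N
      by (subst degree_add_eq_left) (auto simp: Polynomial.degree_monom_eq)
    then have "p \<noteq> 0" using N by auto
    moreover have "pderiv p = -1"
      using assms of_nat_CARD_eq_0[where ?'a = 'a]
      by (simp add: p_def pderiv_diff pderiv_monom power_0_left)
    ultimately have "card {x. poly p x = 0} = ?N"
      using card_roots_eq_degree[of p] deg by simp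
    then show ?thesis by (simp add: R_def p_def poly_monom)
  qed
  then have fin_R: "finite R" using N by (intro card_ge_0_finite) simp
  have only_R: "E = R" if E: "is_extension_of_degree k E" for E
  proof -
    have "finite E" "card E = ?N" "subfield E closure_ring"
      using E card_of_dimension[of k E] by (auto simp: is_extension_of_degree_def)
    then show ?thesis
      using power_card_subfield[of E] card_R fin_R
      by (intro card_subset_eq) (auto simp: R_def)
  qed
  have zero_R: "0 \<in> R" using N by (simp add: R_def)
  have sub_R: "subfield R closure_ring"
  proof (rule subfield_closureI)
    fix x assume x: "x \<in> R"
    have "x ^ ?N + (- x) ^ ?N = 0"
      unfolding power_CARD_add[symmetric] using N by (simp add: zero_power)
    with x show "- x \<in> R"
      by (simp add: R_def add_eq_0_iff)
    show "inverse x \<in> R" using x by (simp add: R_def power_inverse)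
  qed (auto simp: R_def power_CARD_add power_mult_distrib)
  have K_R: "?K \<subseteq> R"
    by (auto simp: R_def finite_field_power_card_power_eq_same simp flip: to_ac_power)
  obtain xs where xs: "set xs = R" using finite_list[OF fin_R] by blast
  have "ring.Span closure_ring ?K xs = R"
  proof (rule antisym)
    show "R \<subseteq> ring.Span closure_ring ?K xs"
      using closure.Span_base_incl[OF subfield_ground_field, of xs] xs by simp
    have "subalgebra ?K R closure_ring"
      using subfield_closureD[OF sub_R] K_R subringE(6) closure.subring_is_ring
      by (intro subalgebra.intro subalgebra_axioms.intro
          subring.axioms(1)[OF subfieldE(1)[OF sub_R]]) auto
    then show "ring.Span closure_ring ?K xs \<subseteq> R"
      by (rule closure.subalgebra_Span_incl[OF subfield_ground_field]) (simp add: xs)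
  qed
  then obtain m where m: "ring.dimension closure_ring m ?K R"
    using closure.Span_finite_dimension[OF subfield_ground_field, of xs]
    by (auto simp: closure.finite_dimension_def)
  then have "CARD('a) ^ m = ?N" using card_of_dimension[OF m] card_R by simp
  then have "m = k" using CARD_finite_field_gt_1[where ?'a = 'a] by simp
  with m sub_R K_R have "is_extension_of_degree k R"
    by (simp add: is_extension_of_degree_def)
  with only_R show ?thesis unfolding R_def[symmetric] by blast
qed

end

lemma extension_field_eq:
  "k > 0 \<Longrightarrow> extension_field k = {x :: 'a :: finite_field alg_closure. x ^ (CARD('a) ^ k) = x}"
  by (simp add: extension_field_def is_extension_of_degree_iff)

lemma ex1_extension_of_degree:
  "k > 0 \<Longrightarrow> \<exists>!E :: 'a :: finite_field alg_closure set. is_extension_of_degree k E"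
  by (simp add: is_extension_of_degree_iff)

end

theory Submission
  imports Defs "HOL-Number_Theory.Pocklington"
begin

text \<open>
  Each step of the sequence is a Kummer extension in disguise: \<open>kummer_generator\<close> writes $\beta_{n+1}$
  as a Moebius transform of a cube root $s$ of $\gamma_n$ and gives
  $\gamma_{n+1} = 9 s / (\beta_n - s)^4$. Put $Q_n = q^{3^n}$. Multiplying conjugates shows that the norm
  of $\gamma_{n+1}$ to $\mathbb{F}_{Q_n}$ is $9^3 \gamma_n$ (\<open>norm_step\<close>). So the cubic residue symbol of
  $\gamma_n$ in $\mathbb{F}_{Q_n}$ is the same nontrivial root of unity $\omega$ for all $n$: no $\gamma_n$
  is a cube, every step has degree 3, and Frobenius acts by $s \mapsto \omega s$.

  An element of $\mathbb{F}_{Q_n}$ is a cube in $\mathbb{F}_{Q_{n+1}}$, hence $\gamma_{n+1}$ generates the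
  larger field. More is true: $\gamma_{n+1}^3$ is not in $\mathbb{F}_{Q_n}$ either
  (\<open>\<gamma>_cube_not_in_subfield\<close>). Otherwise $(\beta_n - s)^4$ would be an eigenvector of
  $s \mapsto \omega s$, which happens only in characteristic 5 with $\gamma_n = 2 = 3^3$, a cube.

  The order of $\gamma_n$ is bounded below by collecting coprime divisors. Since $\gamma_n$ is not a cube,
  the order contains the full 3-part of $Q_n - 1$, which is at least $3^{\mathrm{ord}_3(q-1)+n}$. For every
  $k < n$ a power of $\gamma_n$ is a constant multiple of $\gamma_{k+1}$, and
  $\gamma_{k+1}^3 \notin \mathbb{F}_{Q_k}$ forces the order to have a prime factor $l_k \neq 3$ of
  $Q_k^2 + Q_k + 1$ (\<open>order_prime_factor\<close>). Modulo $l_k$ the number $q$ has order $3^{k+1}$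
  (\<open>ord_eq_three_power\<close>), so the $l_k$ are distinct and $l_k > 3^{k+1}$; together they contribute more
  than $3^{1 + 2 + \cdots + n}$.
\<close>

section \<open>Algebra of one step of the tower\<close>

lemma g_eq: "g x y = (y + 2) ^ 3 - 9 * x ^ 3 * (y\<^sup>2 + y + 1)"
  by (simp add: g_def algebra_simps power2_eq_square power3_eq_cube)

text \<open>Since $g(x,y) = (y+2)^3 - 9x^3(y^2+y+1)$, a root satisfies
  $x^3 - 1 = (y-1)^3 / (9(y^2+y+1)) = (x(y-1)/(y+2))^3$. Hence \<open>s = x (y - 1) / (y + 2)\<close> is a cube
  root of \<open>x\<^sup>3 - 1\<close>, and \<open>y\<close> is a Moebius transform of \<open>s\<close> with coefficients in the field of \<open>x\<close>:
  adjoining \<open>y\<close> amounts to the Kummer extension by \<open>s\<close>. Written through \<open>s\<close>, the next value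
  \<open>y\<^sup>3 - 1\<close> is a monomial in \<open>s\<close> and \<open>x - s\<close>, so its conjugates and its norm can be read off.\<close>
lemma kummer_generator:
  fixes x y :: "'k :: field"
  assumes three: "(3 :: 'k) \<noteq> 0" and x: "x \<noteq> 0" and root: "g x y = 0"
  obtains s where "s ^ 3 = x ^ 3 - 1" "x \<noteq> s" "y = (x + 2 * s) / (x - s)"
    "y ^ 3 - 1 = 9 * s / (x - s) ^ 4"
proof -
  have root': "(y + 2) ^ 3 = 9 * x ^ 3 * (y\<^sup>2 + y + 1)"
    using root by (simp add: g_eq)
  have y: "y + 2 \<noteq> 0"
  proof
    assume "y + 2 = 0"
    then have "y = - 2" by (simp add: eq_neg_iff_add_eq_0)
    then have "3 * (3 * (3 * x ^ 3)) = 0" using root' by simp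
    then show False using three x by (simp only: mult_eq_0_iff power_eq_0_iff) simp
  qed
  define s where "s = x * (y - 1) / (y + 2)"
  have sy: "s * (y + 2) = x * (y - 1)" using y by (simp add: s_def)
  have "s ^ 3 * (y + 2) ^ 3 = (x ^ 3 - 1) * (y + 2) ^ 3"
    using sy root' by Groebner_Basis.algebra
  then have s3: "s ^ 3 = x ^ 3 - 1" using y by simp
  have xs: "x - s \<noteq> 0" using s3 by auto
  have yxs: "y * (x - s) = x + 2 * s" using sy by Groebner_Basis.algebra
  have "(y ^ 3 - 1) * (x - s) ^ 4 = 9 * s"
    using yxs s3 by Groebner_Basis.algebra
  with that s3 xs yxs show thesis by (simp add: field_simps)
qed

lemma cube_root_of_unity_cases:
  fixes \<omega> \<eta> :: "'k :: field"
  assumes \<omega>: "\<omega>\<^sup>2 + \<omega> + 1 = 0" and "\<eta> ^ 3 = 1"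
  shows "\<eta> = 1 \<or> \<eta> = \<omega> \<or> \<eta> = \<omega>\<^sup>2"
proof -
  have "(\<eta> - 1) * ((\<eta> - \<omega>) * (\<eta> - \<omega>\<^sup>2)) = 0" using assms by Groebner_Basis.algebra
  then show ?thesis by auto
qed

text \<open>The hypotheses \<open>eig\<close> say that \<open>(x - s)\<^sup>4\<close> is an eigenvector of the map \<open>s \<mapsto> \<omega> s\<close>. Expanding with
  \<open>s\<^sup>3 = x\<^sup>3 - 1\<close> gives coordinates \<open>a0, a1, a2\<close> with respect to \<open>1, s, s\<^sup>2\<close>, the eigenvectors of this
  map, so an eigenvector has two vanishing coordinates. If \<open>a2 = 6 x\<^sup>2\<close> vanishes, then \<open>2 = 0\<close> and the
  other two do not vanish. So \<open>a0 = a1 = 0\<close>, which forces \<open>5 = 0\<close> and \<open>x\<^sup>3 - 1 = 2\<close>.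
  The conclusion writes \<open>2\<close> as \<open>27 = 3\<^sup>3\<close>, to exhibit a cube.\<close>
lemma quartic_eigenvector_imp_27:
  fixes x s \<omega> \<zeta> :: "'k :: field"
  assumes three: "(3 :: 'k) \<noteq> 0" and \<omega>: "\<omega>\<^sup>2 + \<omega> + 1 = 0" and \<zeta>: "\<zeta> ^ 3 = 1"
    and s3: "s ^ 3 = x ^ 3 - 1" and x: "x \<noteq> 0" and s: "s \<noteq> 0"
    and eig: "\<omega> * (x - s) ^ 4 = \<zeta> * (x - \<omega> * s) ^ 4"
      "\<omega> * (x - \<omega> * s) ^ 4 = \<zeta> * (x - \<omega>\<^sup>2 * s) ^ 4"
  shows "x ^ 3 - 1 = 27"
proof -
  define a0 a1 a2 where "a0 = x * (4 - 3 * x ^ 3)" and "a1 = - 3 * x ^ 3 - 1" and "a2 = 6 * x\<^sup>2"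
  note defs = a0_def a1_def a2_def
  have \<omega>3: "\<omega> ^ 3 = 1" using \<omega> by Groebner_Basis.algebra
  have u0: "(x - s) ^ 4 = a0 + a1 * s + a2 * s\<^sup>2"
    unfolding defs using s3 by Groebner_Basis.algebra
  have u1: "(x - \<omega> * s) ^ 4 = a0 + a1 * (\<omega> * s) + a2 * (\<omega> * s)\<^sup>2"
    unfolding defs using s3 \<omega>3 by Groebner_Basis.algebra
  have u2: "(x - \<omega>\<^sup>2 * s) ^ 4 = a0 + a1 * (\<omega>\<^sup>2 * s) + a2 * (\<omega>\<^sup>2 * s)\<^sup>2"
    unfolding defs using s3 \<omega>3 by Groebner_Basis.algebra
  define U V W where "U = (x - s) ^ 4" and "V = (x - \<omega> * s) ^ 4" and "W = (x - \<omega>\<^sup>2 * s) ^ 4"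
  have \<omega>4: "\<omega> ^ 4 = \<omega>" using \<omega>3 by Groebner_Basis.algebra
  have uvw: "U = a0 + a1 * s + a2 * s\<^sup>2" "V = a0 + \<omega> * (a1 * s) + \<omega>\<^sup>2 * (a2 * s\<^sup>2)"
    "W = a0 + \<omega>\<^sup>2 * (a1 * s) + \<omega> * (a2 * s\<^sup>2)"
    using u0 u1 u2 \<omega>4 by (simp_all add: U_def V_def W_def algebra_simps power_mult_distrib)
  \<comment> \<open>Discrete Fourier inversion on the group of cube roots of unity recovers the coordinates.\<close>
  have c0: "3 * a0 = U + V + W"
    and c1: "3 * (s * a1) = U + \<omega>\<^sup>2 * V + \<omega> * W"
    and c2: "3 * (s\<^sup>2 * a2) = U + \<omega> * V + \<omega>\<^sup>2 * W"
    unfolding uvw using \<omega> by (-, Groebner_Basis.algebra+)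
  note e = eig[folded U_def V_def W_def]
  have nz: "a = 0" if "3 * a = 0" for a :: 'k using that three by simp
  have "\<zeta> = 1 \<or> \<zeta> = \<omega> \<or> \<zeta> = \<omega>\<^sup>2" by (rule cube_root_of_unity_cases[OF \<omega> \<zeta>])
  then have "s * a1 = 0 \<and> s\<^sup>2 * a2 = 0 \<or> a0 = 0 \<and> s * a1 = 0 \<or> a0 = 0 \<and> s\<^sup>2 * a2 = 0"
  proof (elim disjE)
    assume "\<zeta> = 1"
    then have "V = \<omega> * U" using e by simp
    moreover have "W = \<omega>\<^sup>2 * U" using e \<open>\<zeta> = 1\<close> by Groebner_Basis.algebra
    ultimately have "3 * a0 = 0" "3 * (s\<^sup>2 * a2) = 0"
      unfolding c0 c2 using \<omega> by (-, (simp, Groebner_Basis.algebra)+)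
    then show ?thesis using nz by blast
  next
    assume "\<zeta> = \<omega>"
    moreover have "\<omega> \<noteq> 0" using \<omega> by auto
    ultimately have "V = U" "W = U" using e by simp_all
    then have "3 * (s * a1) = (\<omega>\<^sup>2 + \<omega> + 1) * U" "3 * (s\<^sup>2 * a2) = (\<omega>\<^sup>2 + \<omega> + 1) * U"
      unfolding c1 c2 by (simp_all add: algebra_simps)
    then have "3 * (s * a1) = 0" "3 * (s\<^sup>2 * a2) = 0" unfolding \<omega> by simp_all
    then show ?thesis using nz by blast
  next
    assume "\<zeta> = \<omega>\<^sup>2"
    then have "V = \<omega>\<^sup>2 * U" "W = \<omega> * U" using e \<omega>3 by (-, Groebner_Basis.algebra+)
    then have "3 * a0 = 0" "3 * (s * a1) = 0"
      unfolding c0 c1 using \<omega> \<omega>3 by (-, (simp, Groebner_Basis.algebra)+)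
    then show ?thesis using nz by blast
  qed
  then have "a1 = 0 \<and> a2 = 0 \<or> a0 = 0 \<and> a1 = 0 \<or> a0 = 0 \<and> a2 = 0" using s by simp
  moreover have "a2 = 0 \<Longrightarrow> a0 \<noteq> 0 \<and> a1 \<noteq> 0"
  proof -
    assume "a2 = 0"
    then have "2 * x\<^sup>2 = 0" by - (rule nz, simp add: a2_def)
    then have "(2 :: 'k) = 0" using x by simp
    moreover have "(4 :: 'k) = 2 * 2" by simp
    ultimately have four: "(4 :: 'k) = 0" by (simp only: mult_zero_left)
    have "a1 = s ^ 3 - 4 * x ^ 3" unfolding defs s3 by (simp add: algebra_simps)
    then have "a1 = s ^ 3" by (simp add: four)
    moreover have "a0 = - (x * (3 * x ^ 3))" by (simp add: a0_def four)
    ultimately show "a0 \<noteq> 0 \<and> a1 \<noteq> 0" using three x s by simp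
  qed
  ultimately have "a0 = 0" "a1 = 0" by auto
  then have t: "4 - 3 * x ^ 3 = 0" "3 * x ^ 3 + 1 = 0" using x by (auto simp: defs)
  \<comment> \<open>Both brackets vanish and their sum is \<open>5\<close>; also \<open>x\<^sup>3 \<equiv> -2 \<equiv> 28\<close> modulo \<open>5\<close>.\<close>
  have "x ^ 3 - 1 - 27 = 2 * (3 * x ^ 3 + 1) - ((4 - 3 * x ^ 3) + (3 * x ^ 3 + 1)) * (x ^ 3 + 6)"
    by (simp add: algebra_simps)
  then show ?thesis unfolding t by simp
qed

section \<open>Divisibility of $Q^2+Q+1$ and $Q^3-1$\<close>

lemma geometric_div_3:
  fixes Q :: nat
  assumes "Q mod 3 = 1"
  obtains m where "1 + Q + Q\<^sup>2 = 3 * m" "m mod 3 = 1"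
proof -
  obtain k where "Q = 3 * k + 1" using assms by (metis mult_div_mod_eq)
  then have "1 + Q + Q\<^sup>2 = 3 * (1 + 3 * (k + k\<^sup>2))"
    by (simp add: power2_eq_square algebra_simps)
  moreover have "(1 + 3 * (k + k\<^sup>2)) mod 3 = 1"
    by (simp only: mod_mult_self2) simp
  ultimately show thesis by (rule that)
qed

lemma cube_minus_1:
  fixes Q :: nat
  assumes "Q \<ge> 1" shows "Q ^ 3 - 1 = (1 + Q + Q\<^sup>2) * (Q - 1)"
proof -
  obtain r where "Q = Suc r" using assms by (cases Q) auto
  then show ?thesis by (simp add: power2_eq_square power3_eq_cube algebra_simps)
qed

text \<open>Each cubing of \<open>Q \<equiv> 1\<close> modulo 3 multiplies \<open>Q - 1\<close> by \<open>1 + Q + Q\<^sup>2\<close>, a multiple of 3.\<close>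
lemma three_power_dvd_iterated_cube:
  fixes q :: nat
  assumes q: "q mod 3 = 1"
  shows "3 ^ (multiplicity 3 (q - 1) + n) dvd q ^ (3 ^ n) - 1"
proof (induction n)
  case 0
  show ?case by (simp add: multiplicity_dvd)
next
  case (Suc n)
  let ?Q = "q ^ 3 ^ n"
  have "?Q mod 3 = 1" using q by (simp add: power_mod[of q 3, symmetric])
  moreover have "?Q \<ge> 1" using q by (cases q) auto
  moreover have "3 dvd 1 + ?Q + ?Q\<^sup>2"
    using geometric_div_3[OF \<open>?Q mod 3 = 1\<close>] by (metis dvd_triv_left)
  ultimately have "3 * 3 ^ (multiplicity 3 (q - 1) + n) dvd ?Q ^ 3 - 1"
    using Suc cube_minus_1[of ?Q] by (metis mult_dvd_mono)
  then show ?case by (simp add: power_mult[symmetric] mult.commute)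
qed

text \<open>Write \<open>Q = q\<^bsup>3^k\<^esup>\<close>. The prime \<open>l\<close> divides \<open>Q\<^sup>3 - 1\<close>, so the order divides \<open>3\<^bsup>k+1\<^esup>\<close>; were it a proper
  divisor, then \<open>Q \<equiv> 1\<close> and \<open>1 + Q + Q\<^sup>2 \<equiv> 3\<close> modulo \<open>l\<close>. Consequently \<open>l > 3\<^bsup>k+1\<^esup>\<close>, and different \<open>k\<close>
  give different primes \<open>l\<close>.\<close>
lemma ord_eq_three_power:
  fixes q l :: nat
  assumes l: "Factorial_Ring.prime l" "l \<noteq> 3" and dvd: "l dvd 1 + q ^ 3 ^ k + (q ^ 3 ^ k)\<^sup>2" and q: "q \<ge> 1"
  shows "Pocklington.ord l q = 3 ^ Suc k"
proof -
  let ?Q = "q ^ 3 ^ k"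
  have Q: "?Q \<ge> 1" using q by simp
  have "l dvd ?Q ^ 3 - 1" unfolding cube_minus_1[OF Q] using dvd by (rule dvd_mult2)
  then have "[?Q ^ 3 = 1] (mod l)" using Q by (simp add: cong_altdef_nat)
  then have "[q ^ 3 ^ Suc k = 1] (mod l)" by (simp only: power_Suc2 power_mult)
  then have "Pocklington.ord l q dvd 3 ^ Suc k" by (simp add: ord_divides')
  then obtain j where j: "j \<le> Suc k" "Pocklington.ord l q = 3 ^ j"
    by (auto simp: divides_primepow_nat[of 3] simp del: power_Suc)
  have "\<not> j \<le> k"
  proof
    assume "j \<le> k"
    then have "Pocklington.ord l q dvd 3 ^ k" unfolding j(2) by (rule le_imp_power_dvd)
    then have c: "[?Q = 1] (mod l)" by (simp add: ord_divides')
    have "[1 + ?Q + ?Q\<^sup>2 = 1 + 1 + 1\<^sup>2] (mod l)" by (intro cong_add cong_refl cong_pow c)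
    then have "l dvd 1 + 1 + 1\<^sup>2" using dvd by (simp only: cong_dvd_iff)
    then have "l dvd 3" by (simp add: numeral_3_eq_3)
    then show False using l by (simp add: primes_dvd_imp_eq)
  qed
  with j have "j = Suc k" by simp
  with j show ?thesis by simp
qed

section \<open>Frobenius powers, degrees and orders in the algebraic closure\<close>

lemma power_CARD_diff:
  fixes x y :: "'a :: finite_field alg_closure"
  shows "(x - y) ^ (CARD('a) ^ k) = x ^ (CARD('a) ^ k) - y ^ (CARD('a) ^ k)"
  using power_CARD_add[of "x - y" y k] by (simp add: algebra_simps)

lemma power_CARD_of_nat:
  "(of_nat m :: 'a :: finite_field alg_closure) ^ (CARD('a) ^ k) = of_nat m"
proof (induction m)
  case 0
  show ?case using CARD_finite_field_gt_1[where ?'a = 'a] by (simp add: power_0_left)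
next
  case (Suc m)
  then show ?case by (simp add: power_CARD_add)
qed

lemma power_CARD_numeral:
  "(numeral m :: 'a :: finite_field alg_closure) ^ (CARD('a) ^ k) = numeral m"
  using power_CARD_of_nat[of "numeral m" k, where ?'a = 'a] by simp

lemma is_extension_of_degree_extension_field:
  "k > 0 \<Longrightarrow> is_extension_of_degree k (extension_field k :: 'a :: finite_field alg_closure set)"
  by (simp add: is_extension_of_degree_iff extension_field_eq)

lemma ground_field_eq: "ground_field = {x :: 'a :: finite_field alg_closure. x ^ CARD('a) = x}"
proof -
  interpret closure: field "closure_ring :: 'a alg_closure ring" by (rule field_from_type_algebra)
  have "is_extension_of_degree 1 (ground_field :: 'a alg_closure set)"
    using closure.dimension_one[OF subfield_ground_field] subfield_ground_field
    by (simp add: is_extension_of_degree_def)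
  then show ?thesis by (simp add: is_extension_of_degree_iff)
qed

lemma three_neq_0:
  assumes "CARD('a :: finite_field) mod 3 = 1"
  shows "(3 :: 'a alg_closure) \<noteq> 0"
proof
  assume 3: "(3 :: 'a alg_closure) = 0"
  obtain k where "CARD('a) = 3 * k + 1" using assms by (metis mult_div_mod_eq)
  then have "(of_nat CARD('a) :: 'a alg_closure) = 3 * of_nat k + 1" by simp
  then show False using 3 of_nat_CARD_eq_0[where ?'a = 'a] by simp
qed

text \<open>The cube root taken in the algebraic closure is fixed by the Frobenius map, hence lies in the
  ground field.\<close>
lemma cube_if_power_eq_1:
  fixes a :: "'a :: finite_field"
  assumes q: "CARD('a) mod 3 = 1" and pow: "a ^ ((CARD('a) - 1) div 3) = 1"
  shows "\<exists>y. a = y ^ 3"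
proof -
  obtain s :: "'a alg_closure" where s: "s ^ 3 = to_ac a"
    using nth_root_exists[of 3 "to_ac a"] by auto
  obtain k where k: "CARD('a) = 3 * k + 1" using q by (metis mult_div_mod_eq)
  have "s ^ CARD('a) = s * (s ^ 3) ^ k" by (simp add: k power_mult)
  also have "\<dots> = s" using pow by (simp add: s k flip: to_ac_power)
  finally have "s \<in> ground_field" by (simp add: ground_field_eq)
  then obtain y where "s = to_ac y" by blast
  then have "to_ac a = to_ac (y ^ 3)" using s by simp
  then have "a = y ^ 3" by (simp only: to_ac_eq_iff)
  then show ?thesis by blast
qed

lemma power_gcd_eq_1:
  fixes z :: "'k :: field"
  assumes "z ^ a = 1" "z ^ b = 1"
  shows "z ^ gcd a b = 1"
proof (cases "a = 0")
  case False
  then obtain u v where "a * u = b * v + gcd a b" using bezout_nat by blast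
  then have "z ^ (a * u) = z ^ (b * v) * z ^ gcd a b" by (simp add: power_add)
  then show ?thesis using assms by (simp add: power_mult)
qed (use assms in simp)

lemma power_minus_1_eq_1:
  fixes z :: "'k :: field"
  assumes "z ^ N = z" "z \<noteq> 0" "N \<ge> 1"
  shows "z ^ (N - 1) = 1"
proof -
  have "z * z ^ (N - 1) = z" using assms by (metis power_minus_mult mult.commute zero_less_one less_le_trans)
  then show ?thesis using assms by simp
qed

lemma iterated_frobenius_fixed:
  fixes x :: "'k :: monoid_mult"
  assumes "x ^ (q ^ a) = x"
  shows "x ^ (q ^ (a * u)) = x"
  by (induction u) (use assms in \<open>simp_all add: power_add power_mult\<close>)

lemma frobenius_fixed_gcd:
  fixes x :: "'k :: monoid_mult"
  assumes a: "x ^ (q ^ a) = x" and b: "x ^ (q ^ b) = x" and "a \<noteq> 0"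
  shows "x ^ (q ^ gcd a b) = x"
proof -
  obtain u v where uv: "a * u = b * v + gcd a b" using bezout_nat \<open>a \<noteq> 0\<close> by blast
  have "x = x ^ (q ^ (a * u))" using iterated_frobenius_fixed[OF a] by simp
  also have "\<dots> = (x ^ (q ^ (b * v))) ^ (q ^ gcd a b)"
    by (simp only: uv power_add power_mult)
  also have "\<dots> = x ^ (q ^ gcd a b)" using iterated_frobenius_fixed[OF b] by simp
  finally show ?thesis by simp
qed

text \<open>The simple extension generated by \<open>x\<close> has the degree of \<open>x\<close> as its dimension, and an extension of
  dimension \<open>d\<close> is the fixed field of the \<open>d\<close>-th power of Frobenius. This translates the degree into
  statements about Frobenius powers.\<close>
lemma degree_over_ground_props:
  fixes x :: "'a :: finite_field alg_closure"
  assumes m: "m > 0" and x: "x ^ (CARD('a) ^ m) = x"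
  shows "0 < degree_over_ground x" "degree_over_ground x \<le> m"
    "x ^ (CARD('a) ^ degree_over_ground x) = x"
proof -
  interpret closure: field "closure_ring :: 'a alg_closure ring" by (rule field_from_type_algebra)
  let ?K = "ground_field :: 'a alg_closure set" and ?F = "extension_field m :: 'a alg_closure set"
  let ?d = "degree_over_ground x"
  define E where "E = closure.simple_extension ?K x"
  have F: "subfield ?F closure_ring" "?K \<subseteq> ?F" "closure.dimension m ?K ?F"
    using is_extension_of_degree_extension_field[OF m, where ?'a = 'a]
    by (auto simp: is_extension_of_degree_def)
  have xF: "x \<in> ?F" using x by (simp add: extension_field_eq[OF m])
  have alg: "closure.algebraic ?K x"
    using closure.finite_dimension_imp_algebraic[OF subfield_ground_field subfieldE(1)[OF F(1)]
        closure.finite_dimensionI[OF F(3)] xF] by (simp add: over_def)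
  have sub: "subfield E closure_ring"
    unfolding E_def using alg closure.simple_extension_is_subfield[OF subfield_ground_field]
    by (simp add: over_def)
  have KE: "?K \<subseteq> E"
    unfolding E_def by (rule closure.simple_extension_incl) simp_all
  have xE: "x \<in> E"
    unfolding E_def
    by (rule closure.simple_extension_mem[OF subfieldE(1)[OF subfield_ground_field]]) simp
  have dim: "closure.dimension ?d ?K E"
    unfolding E_def degree_over_ground_def
    by (rule closure.dimension_simple_extension[OF subfield_ground_field])
      (use alg in \<open>simp_all add: over_def\<close>)
  note card_E = card_of_dimension[OF dim] and card_F = card_of_dimension[OF F(3)]
  have "card {0, 1 :: 'a alg_closure} \<le> card E"
    using card_E subfield_closureD(1,2)[OF sub] by (intro card_mono) auto
  then show "0 < ?d" using card_E by (cases "?d") auto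
  then show "x ^ (CARD('a) ^ ?d) = x"
    using sub KE dim xE is_extension_of_degree_iff[of ?d E] by (auto simp: is_extension_of_degree_def)
  have "E \<subseteq> ?F"
    unfolding E_def by (rule closure.simple_extension_subring_incl[OF subfieldE(1)[OF F(1)] F(2) xF])
  then have "card E \<le> card ?F" using card_F by (intro card_mono) auto
  then have "CARD('a) ^ ?d \<le> CARD('a) ^ m" using card_E card_F by simp
  then show "?d \<le> m"
    by (rule power_le_imp_le_exp[OF CARD_finite_field_gt_1])
qed

text \<open>The exponents of Frobenius that fix \<open>x\<close> are closed under greatest common divisors. If the degree
  were not divisible by \<open>p\<^bsup>n+1\<^esup>\<close>, its gcd with \<open>p\<^bsup>n+1\<^esup>\<close> would divide \<open>p\<^bsup>n\<^esup>\<close>.\<close>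
lemma degree_over_ground_eq_prime_power:
  fixes x :: "'a :: finite_field alg_closure"
  assumes p: "Factorial_Ring.prime p" and fixed: "x ^ (CARD('a) ^ (p ^ Suc n)) = x"
    and not_fixed: "x ^ (CARD('a) ^ (p ^ n)) \<noteq> x"
  shows "degree_over_ground x = p ^ Suc n"
proof -
  let ?d = "degree_over_ground x"
  have pos: "p ^ Suc n > 0" using p prime_gt_0_nat by auto
  note d = degree_over_ground_props[OF pos fixed]
  obtain j where j: "gcd ?d (p ^ Suc n) = p ^ j" "j \<le> Suc n"
    by (metis divides_primepow_nat[OF p] gcd_dvd2)
  have fixed_j: "x ^ (CARD('a) ^ (p ^ j)) = x"
    using frobenius_fixed_gcd[OF d(3) fixed] d(1) j(1) by simp
  have "\<not> j \<le> n"
  proof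
    assume "j \<le> n"
    then have "p ^ n = p ^ j * p ^ (n - j)" by (simp flip: power_add)
    then show False using iterated_frobenius_fixed[OF fixed_j] not_fixed by simp
  qed
  then have "j = Suc n" using j(2) by simp
  then have "p ^ Suc n dvd ?d" using j(1) by (metis gcd_dvd1)
  then show ?thesis using d(1,2) by (meson dvd_imp_le le_antisym)
qed

lemma extension_units_props:
  fixes x :: "'a :: finite_field alg_closure"
  assumes m: "m > 0" and x: "x ^ (CARD('a) ^ m) = x" and nz: "x \<noteq> 0"
  shows "x \<in> carrier (extension_units m)"
    and "x ^ k = 1 \<longleftrightarrow> group.ord (extension_units m) x dvd k"
proof -
  let ?F = "extension_field m :: 'a alg_closure set"
  let ?R = "closure_ring \<lparr>carrier := ?F\<rparr>"
  interpret closure: field "closure_ring :: 'a alg_closure ring" by (rule field_from_type_algebra)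
  have "subfield ?F closure_ring"
    using is_extension_of_degree_extension_field[OF m, where ?'a = 'a]
    by (simp add: is_extension_of_degree_def)
  then have "group (Multiplicative_Group.mult_of ?R)"
    by (intro field.field_mult_group closure.subfield_iff(2))
  \<comment> \<open>The two constants called \<open>mult_of\<close> have the same defining equation.\<close>
  then have units: "group (mult_of ?R)"
    by (simp only: Ring_Divisibility.mult_of_def Multiplicative_Group.mult_of_def)
  show mem: "x \<in> carrier (extension_units m)"
    using x nz by (simp add: extension_units_def extension_field_eq[OF m])
  have pow: "x [^]\<^bsub>mult_of ?R\<^esub> k = x ^ k" for k :: nat
    by (induction k) (simp_all add: mult.commute)
  have one: "\<one>\<^bsub>mult_of ?R\<^esub> = 1" by simp
  show "x ^ k = 1 \<longleftrightarrow> group.ord (extension_units m) x dvd k"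
    using group.pow_eq_id[OF units mem[unfolded extension_units_def], of k]
    unfolding extension_units_def pow one .
qed

section \<open>Noncubes along the tower\<close>

text \<open>The constant \<open>\<omega>\<close> is the cubic residue symbol of \<open>\<gamma> 0\<close> in the ground field; \<open>\<omega> \<noteq> 1\<close> expresses that
  \<open>\<gamma> 0\<close> is not a cube there.\<close>
locale cubic_tower =
  fixes q :: nat and \<beta> \<gamma> :: "nat \<Rightarrow> 'a :: finite_field alg_closure" and \<omega> :: "'a alg_closure"
  assumes q: "q = CARD('a)" "q mod 3 = 1"
    and \<beta>_0: "\<beta> 0 ^ q = \<beta> 0"
    and \<beta>_root: "\<And>n. g (\<beta> n) (\<beta> (Suc n)) = 0"
    and \<gamma>: "\<And>n. \<gamma> n = \<beta> n ^ 3 - 1"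
    and \<gamma>_0: "\<gamma> 0 \<noteq> 0"
    and \<omega>: "\<gamma> 0 ^ ((q - 1) div 3) = \<omega>" "\<omega> \<noteq> 1"
begin

abbreviation Q :: "nat \<Rightarrow> nat" where "Q n \<equiv> q ^ 3 ^ n"

lemma Q_mod_3: "Q n mod 3 = 1"
  using q(2) by (simp add: power_mod[of q 3, symmetric])

lemma Q_gt_0: "Q n \<ge> 1"
  using Q_mod_3[of n] by (cases "Q n") auto

lemma Q_Suc: "Q (Suc n) = Q n ^ 3"
  by (simp only: power_Suc2 power_mult)

lemma three_times_Q_div: "3 * ((Q n - 1) div 3) = Q n - 1"
proof -
  have "3 dvd Q n - 1" using Q_mod_3[of n]
    by (metis mod_eq_dvd_iff_nat Q_gt_0 mod_less one_less_numeral_iff semiring_norm(77))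
  then show ?thesis by simp
qed

lemma Q_eq: "Q n = 3 * ((Q n - 1) div 3) + 1"
  using three_times_Q_div[of n] Q_gt_0[of n] by simp

lemma three: "(3 :: 'a alg_closure) \<noteq> 0"
  using q by (intro three_neq_0) simp

lemma nine: "(9 :: 'a alg_closure) \<noteq> 0"
proof -
  have "(9 :: 'a alg_closure) = 3 * 3" by simp
  then show ?thesis using three by (simp only: mult_eq_0_iff) simp
qed

lemma frobenius_add: "(x + y :: 'a alg_closure) ^ Q n = x ^ Q n + y ^ Q n"
  unfolding q(1) by (rule power_CARD_add)

lemma frobenius_diff: "(x - y :: 'a alg_closure) ^ Q n = x ^ Q n - y ^ Q n"
  unfolding q(1) by (rule power_CARD_diff)

lemma frobenius_numeral: "(numeral m :: 'a alg_closure) ^ Q n = numeral m"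
  unfolding q(1) by (rule power_CARD_numeral)

lemmas frobenius = frobenius_add frobenius_diff frobenius_numeral power_mult_distrib power_divide

lemma frobenius_power: "((x :: 'a alg_closure) ^ m) ^ Q n = (x ^ Q n) ^ m"
  by (simp add: power_mult[symmetric] mult.commute)

lemma cube_root_of_unity_fixed: "(x :: 'a alg_closure) ^ 3 = 1 \<Longrightarrow> x ^ Q n = x"
  by (subst Q_eq) (simp add: power_mult)

lemma \<omega>_cube: "\<omega> ^ 3 = 1"
proof -
  have "\<gamma> 0 ^ Q 0 = \<gamma> 0" using frobenius_diff[of _ _ 0] frobenius_power[of _ _ 0] \<beta>_0 by (simp add: \<gamma>)
  then have "\<gamma> 0 ^ (Q 0 - 1) = 1" using \<gamma>_0 Q_gt_0 by (rule power_minus_1_eq_1)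
  then have "(\<gamma> 0 ^ ((Q 0 - 1) div 3)) ^ 3 = 1"
    by (simp only: power_mult[symmetric] mult.commute[of _ 3] three_times_Q_div)
  then show ?thesis using \<omega> by simp
qed

lemma \<omega>_quadratic: "\<omega>\<^sup>2 + \<omega> + 1 = 0"
proof -
  have "(\<omega> - 1) * (\<omega>\<^sup>2 + \<omega> + 1) = 0" using \<omega>_cube by Groebner_Basis.algebra
  then show ?thesis using \<omega>(2) by simp
qed

lemma \<omega>_fixed: "\<omega> ^ Q n = \<omega>"
  using \<omega>_cube by (rule cube_root_of_unity_fixed)

lemma cube_power_eq_1:
  assumes "x ^ Q n = (x :: 'a alg_closure)" "x \<noteq> 0"
  shows "(x ^ 3) ^ ((Q n - 1) div 3) = 1"
  using power_minus_1_eq_1[OF assms Q_gt_0] by (simp only: power_mult[symmetric] three_times_Q_div)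

text \<open>The induction invariant along the tower: \<open>\<beta> n\<close> lies in the extension of degree \<open>3\<^bsup>n\<^esup>\<close>, and the cubic
  residue symbol of \<open>\<gamma> n\<close> in that field is \<open>\<omega>\<close>. The symbol does not depend on \<open>n\<close>, so
  at every level the \<open>Q n\<close>-power map sends a cube root \<open>s\<close> of \<open>\<gamma> n\<close> to \<open>\<omega> s\<close>.\<close>
definition noncube_level :: "nat \<Rightarrow> bool"
  where "noncube_level n \<longleftrightarrow> \<beta> n ^ Q n = \<beta> n \<and> \<gamma> n \<noteq> 0 \<and> \<gamma> n ^ ((Q n - 1) div 3) = \<omega>"

text \<open>Frobenius multiplies the cube root \<open>s\<close> of \<open>\<gamma> n\<close> by \<open>s\<^bsup>Q n - 1\<^esup>\<close>, which is the cubic residue symbol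
  of \<open>\<gamma> n\<close>. The value \<open>\<beta> n = 0\<close> is excluded because it would make \<open>\<gamma> n = (-1)\<^sup>3\<close> a cube.\<close>
lemma kummer_step:
  assumes "noncube_level n"
  obtains s where "s ^ 3 = \<gamma> n" "s \<noteq> 0" "\<beta> n \<noteq> 0" "\<beta> n ^ 3 - s ^ 3 = 1" "s ^ Q n = \<omega> * s"
    "\<beta> (Suc n) = (\<beta> n + 2 * s) / (\<beta> n - s)" "\<gamma> (Suc n) = 9 * s / (\<beta> n - s) ^ 4"
proof -
  have fixed: "\<beta> n ^ Q n = \<beta> n" and nz: "\<gamma> n \<noteq> 0" and pow: "\<gamma> n ^ ((Q n - 1) div 3) = \<omega>"
    using assms by (auto simp: noncube_level_def)
  have \<beta>: "\<beta> n \<noteq> 0"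
  proof
    assume "\<beta> n = 0"
    then have "\<gamma> n = (0 - 1) ^ 3" by (simp add: \<gamma>)
    moreover have "q > 0" using q(2) by (cases q) auto
    then have "((0 - 1) :: 'a alg_closure) ^ Q n = 0 - 1"
      unfolding frobenius_diff by (simp add: power_0_left)
    ultimately show False using cube_power_eq_1[of "0 - 1" n] pow \<omega>(2) by simp
  qed
  obtain s where s: "s ^ 3 = \<beta> n ^ 3 - 1" "\<beta> (Suc n) = (\<beta> n + 2 * s) / (\<beta> n - s)"
    "\<beta> (Suc n) ^ 3 - 1 = 9 * s / (\<beta> n - s) ^ 4"
    using kummer_generator[OF three \<beta> \<beta>_root] .
  have s3: "s ^ 3 = \<gamma> n" using s(1) by (simp add: \<gamma>)
  have "s ^ Q n = s * (s ^ 3) ^ ((Q n - 1) div 3)"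
    by (subst Q_eq) (simp add: power_mult)
  then have sQ: "s ^ Q n = \<omega> * s" using pow s3 by (simp add: mult.commute)
  have s_nz: "s \<noteq> 0" using s3 nz by auto
  have diff: "\<beta> n ^ 3 - s ^ 3 = 1" using s(1) by simp
  show thesis by (rule that[OF s3 s_nz \<beta> diff sQ s(2) s(3)[folded \<gamma>]])
qed

text \<open>The left-hand side is the norm of \<open>\<gamma> (Suc n)\<close> to the field below, a product over the conjugates
  \<open>9 \<omega>\<^sup>i s / (\<beta> n - \<omega>\<^sup>i s)\<^sup>4\<close>. The denominators multiply to \<open>(\<beta> n ^ 3 - s ^ 3)\<^sup>4 = 1\<close>.\<close>
lemma norm_step:
  assumes "noncube_level n"
  shows "\<gamma> (Suc n) ^ (1 + Q n + (Q n)\<^sup>2) = 729 * \<gamma> n"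
proof -
  have fixed: "\<beta> n ^ Q n = \<beta> n" using assms by (auto simp: noncube_level_def)
  obtain s where s: "s ^ 3 = \<gamma> n" "\<beta> n ^ 3 - s ^ 3 = 1" "s ^ Q n = \<omega> * s"
    and c: "\<gamma> (Suc n) = 9 * s / (\<beta> n - s) ^ 4"
    using kummer_step[OF assms] by metis
  have c1: "\<gamma> (Suc n) ^ Q n = 9 * (\<omega> * s) / (\<beta> n - \<omega> * s) ^ 4"
    unfolding c by (simp add: frobenius frobenius_power fixed s(3))
  have c2: "\<gamma> (Suc n) ^ (Q n)\<^sup>2 = 9 * (\<omega>\<^sup>2 * s) / (\<beta> n - \<omega>\<^sup>2 * s) ^ 4"
    unfolding power2_eq_square[of "Q n"] power_mult c1
    by (simp add: frobenius frobenius_power fixed s(3) \<omega>_fixed power2_eq_square mult.assoc)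
  have "(\<beta> n - s) * (\<beta> n - \<omega> * s) * (\<beta> n - \<omega>\<^sup>2 * s) = 1"
    using s(2) \<omega>_quadratic by Groebner_Basis.algebra
  then have d: "(\<beta> n - s) ^ 4 * (\<beta> n - \<omega> * s) ^ 4 * (\<beta> n - \<omega>\<^sup>2 * s) ^ 4 = 1"
    by (simp only: power_mult_distrib[symmetric] power_one)
  have "\<gamma> (Suc n) ^ (1 + Q n + (Q n)\<^sup>2) =
      (9 * s) * (9 * (\<omega> * s)) * (9 * (\<omega>\<^sup>2 * s)) /
      ((\<beta> n - s) ^ 4 * (\<beta> n - \<omega> * s) ^ 4 * (\<beta> n - \<omega>\<^sup>2 * s) ^ 4)"
    unfolding power_add power_one_right c1 c2 by (simp add: c)
  also have "\<dots> = 729 * (\<omega> ^ 3 * s ^ 3)"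
    unfolding d by (simp add: power2_eq_square power3_eq_cube)
  finally show ?thesis by (simp add: \<omega>_cube s(1))
qed

text \<open>The cubic residue symbol of an element equals that of its norm, and \<open>norm_step\<close> shows that the norm
  of \<open>\<gamma> (Suc n)\<close> is the cube \<open>9\<^sup>3\<close> times \<open>\<gamma> n\<close>.\<close>
lemma noncube_level: "noncube_level n"
proof (induction n)
  case 0
  show ?case using \<beta>_0 \<gamma>_0 \<omega> by (simp add: noncube_level_def)
next
  case (Suc n)
  have fixed: "\<beta> n ^ Q n = \<beta> n" and pow: "\<gamma> n ^ ((Q n - 1) div 3) = \<omega>"
    using Suc by (auto simp: noncube_level_def)
  obtain s where s: "s \<noteq> 0" "\<beta> n ^ 3 - s ^ 3 = 1" "s ^ Q n = \<omega> * s"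
    and b: "\<beta> (Suc n) = (\<beta> n + 2 * s) / (\<beta> n - s)"
    and c: "\<gamma> (Suc n) = 9 * s / (\<beta> n - s) ^ 4"
    using kummer_step[OF Suc] by metis
  have iter: "z ^ Q (Suc n) = ((z ^ Q n) ^ Q n) ^ Q n" for z :: "'a alg_closure"
    by (simp only: Q_Suc power_mult[symmetric] power3_eq_cube)
  have "s ^ Q (Suc n) = s"
    using \<omega>_cube unfolding iter
    by (simp add: s(3) power_mult_distrib \<omega>_fixed power3_eq_cube mult.assoc)
  moreover have "\<beta> n ^ Q (Suc n) = \<beta> n" unfolding iter by (simp add: fixed)
  ultimately have "\<beta> (Suc n) ^ Q (Suc n) = \<beta> (Suc n)"
    unfolding b by (simp only: frobenius)
  moreover have "\<gamma> (Suc n) \<noteq> 0" using s nine by (auto simp: c)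
  moreover have "\<gamma> (Suc n) ^ ((Q (Suc n) - 1) div 3) = \<omega>"
  proof -
    have "(Q (Suc n) - 1) div 3 = (1 + Q n + (Q n)\<^sup>2) * ((Q n - 1) div 3)"
      unfolding Q_Suc cube_minus_1[OF Q_gt_0] by (subst three_times_Q_div[symmetric]) simp
    then have "\<gamma> (Suc n) ^ ((Q (Suc n) - 1) div 3) = (729 * \<gamma> n) ^ ((Q n - 1) div 3)"
      by (simp only: power_mult norm_step[OF Suc])
    also have "\<dots> = (9 ^ 3) ^ ((Q n - 1) div 3) * \<omega>"
      by (simp only: power_mult_distrib pow) simp
    also have "(9 ^ 3 :: 'a alg_closure) ^ ((Q n - 1) div 3) = 1"
      by (rule cube_power_eq_1[OF frobenius_numeral nine])
    finally show ?thesis by simp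
  qed
  ultimately show ?case by (simp add: noncube_level_def)
qed

lemma \<gamma>_nz: "\<gamma> n \<noteq> 0"
  using noncube_level[of n] by (simp add: noncube_level_def)

lemma \<gamma>_power: "\<gamma> n ^ ((Q n - 1) div 3) = \<omega>"
  using noncube_level[of n] by (simp add: noncube_level_def)

lemma \<beta>_fixed: "\<beta> n ^ Q n = \<beta> n"
  using noncube_level[of n] by (simp add: noncube_level_def)

lemma \<gamma>_fixed: "\<gamma> n ^ Q n = \<gamma> n"
proof -
  have "(\<beta> n ^ 3 - 1) ^ Q n = (\<beta> n ^ 3) ^ Q n - 1"
    by (simp only: frobenius_diff power_one)
  also have "(\<beta> n ^ 3) ^ Q n = \<beta> n ^ 3"
    by (simp only: frobenius_power[of _ 3] \<beta>_fixed)
  finally show ?thesis by (simp add: \<gamma>)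
qed

lemma \<gamma>_power_Q_minus_1: "\<gamma> n ^ (Q n - 1) = 1"
  using \<gamma>_fixed \<gamma>_nz Q_gt_0 by (rule power_minus_1_eq_1)

text \<open>If the cube of \<open>\<gamma> (Suc n)\<close> were fixed by the \<open>Q n\<close>-power map, then this map would multiply
  \<open>\<gamma> (Suc n) = 9 s / (\<beta> n - s)\<^sup>4\<close> by a cube root of unity \<open>\<zeta>\<close>, making \<open>(\<beta> n - s)\<^sup>4\<close> an eigenvector of
  \<open>s \<mapsto> \<omega> s\<close>. Then \<open>\<gamma> n = 27\<close> would be a cube.\<close>
lemma \<gamma>_cube_not_in_subfield: "\<gamma> (Suc n) ^ (3 * (Q n - 1)) \<noteq> 1"
proof
  assume one: "\<gamma> (Suc n) ^ (3 * (Q n - 1)) = 1"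
  obtain s where s: "s ^ 3 = \<gamma> n" "s \<noteq> 0" "\<beta> n \<noteq> 0" "\<beta> n ^ 3 - s ^ 3 = 1" "s ^ Q n = \<omega> * s"
    and c: "\<gamma> (Suc n) = 9 * s / (\<beta> n - s) ^ 4"
    using kummer_step[OF noncube_level] by metis
  define \<zeta> where "\<zeta> = \<gamma> (Suc n) ^ (Q n - 1)"
  have \<zeta>3: "\<zeta> ^ 3 = 1" using one by (simp add: \<zeta>_def mult.commute flip: power_mult)
  have "\<gamma> (Suc n) ^ Q n = \<zeta> * \<gamma> (Suc n)"
    unfolding \<zeta>_def by (metis power_minus_mult Q_gt_0 less_le_trans zero_less_one)
  moreover have "\<gamma> (Suc n) ^ Q n = 9 * (\<omega> * s) / (\<beta> n - \<omega> * s) ^ 4"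
    unfolding c by (simp add: frobenius frobenius_power \<beta>_fixed s(5))
  ultimately have "9 * (\<omega> * s) / (\<beta> n - \<omega> * s) ^ 4 = \<zeta> * (9 * s / (\<beta> n - s) ^ 4)"
    by (simp add: c)
  moreover have "\<beta> n - s \<noteq> 0" using s(4) by auto
  moreover have "\<beta> n - \<omega> * s \<noteq> 0"
    using s(4) \<omega>_cube by (auto simp: power_mult_distrib)
  ultimately have "9 * s * (\<omega> * (\<beta> n - s) ^ 4) = 9 * s * (\<zeta> * (\<beta> n - \<omega> * s) ^ 4)"
    by (simp add: field_simps)
  then have e1: "\<omega> * (\<beta> n - s) ^ 4 = \<zeta> * (\<beta> n - \<omega> * s) ^ 4"
    using s(2) nine by simp
  then have "(\<omega> * (\<beta> n - s) ^ 4) ^ Q n = (\<zeta> * (\<beta> n - \<omega> * s) ^ 4) ^ Q n" by simp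
  then have e2: "\<omega> * (\<beta> n - \<omega> * s) ^ 4 = \<zeta> * (\<beta> n - \<omega>\<^sup>2 * s) ^ 4"
    by (simp add: frobenius frobenius_power \<beta>_fixed s(5) \<omega>_fixed
        cube_root_of_unity_fixed[OF \<zeta>3] power2_eq_square mult.assoc)
  have "\<beta> n ^ 3 - 1 = 27"
    using three \<omega>_quadratic \<zeta>3 _ s(3,2) e1 e2
    by (rule quartic_eigenvector_imp_27) (use s(4) in \<open>simp add: algebra_simps\<close>)
  then have "\<gamma> n = 3 ^ 3" by (simp add: \<gamma>)
  then show False
    using cube_power_eq_1[OF frobenius_numeral[of _ n] three] \<gamma>_power[of n] \<omega>(2)
    by (simp only: simp_thms)
qed

lemma degree_\<gamma>:
  assumes "n \<ge> 1"
  shows "degree_over_ground (\<gamma> n) = 3 ^ n"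
proof -
  obtain k where n: "n = Suc k" using assms by (cases n) auto
  have "\<gamma> (Suc k) ^ Q k \<noteq> \<gamma> (Suc k)"
  proof
    assume "\<gamma> (Suc k) ^ Q k = \<gamma> (Suc k)"
    then have "\<gamma> (Suc k) ^ (Q k - 1) = 1" using \<gamma>_nz Q_gt_0 by (rule power_minus_1_eq_1)
    then show False using \<gamma>_cube_not_in_subfield[of k] by (simp add: power_mult mult.commute[of 3])
  qed
  then show ?thesis
    using degree_over_ground_eq_prime_power[of 3 "\<gamma> (Suc k)" k] \<gamma>_fixed[of "Suc k"]
    unfolding q(1) n by simp
qed

section \<open>The multiplicative order\<close>

text \<open>Norms are powers and compose, and \<open>norm_step\<close> contributes a factor \<open>729\<close> in the prime field at each
  level.\<close>
lemma iterated_norm: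
  assumes "k \<le> n"
  shows "\<exists>M c. \<gamma> n ^ M = 729 ^ c * \<gamma> k"
  using assms
proof (induction n rule: dec_induct)
  case base
  have "\<gamma> k ^ 1 = 729 ^ 0 * \<gamma> k" by simp
  then show ?case by blast
next
  case (step n)
  then obtain M c where "\<gamma> n ^ M = 729 ^ c * \<gamma> k" by blast
  then have "\<gamma> (Suc n) ^ ((1 + Q n + (Q n)\<^sup>2) * M) = 729 ^ (M + c) * \<gamma> k"
    unfolding power_mult norm_step[OF noncube_level] by (simp add: power_mult_distrib power_add)
  then show ?case by blast
qed

text \<open>A power of \<open>\<gamma> n\<close> is a constant times \<open>\<gamma> (Suc k)\<close>; the order of this product divides
  \<open>Q (Suc k) - 1 = 3 m (Q k - 1)\<close> with \<open>3 m = 1 + Q k + (Q k)\<^sup>2\<close>. If the order of \<open>\<gamma> n\<close> were coprime to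
  \<open>m\<close>, the factor \<open>m\<close> could be dropped, and the cube of \<open>\<gamma> (Suc k)\<close> would lie in the field below.\<close>
lemma order_prime_factor:
  assumes ord: "\<And>m. \<gamma> n ^ m = 1 \<longleftrightarrow> d dvd m" and k: "k < n"
  shows "\<exists>l. Factorial_Ring.prime l \<and> l \<noteq> 3 \<and> l dvd 1 + Q k + (Q k)\<^sup>2 \<and> l dvd d"
proof -
  obtain m where m: "1 + Q k + (Q k)\<^sup>2 = 3 * m" "m mod 3 = 1"
    using geometric_div_3[OF Q_mod_3] .
  have "\<not> coprime d m"
  proof
    assume cop: "coprime d m"
    obtain M c where M: "\<gamma> n ^ M = 729 ^ c * \<gamma> (Suc k)" using iterated_norm[of "Suc k" n] k by auto
    have const: "((729 :: 'a alg_closure) ^ c) ^ (Q j - 1) = 1" for j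
    proof (rule power_minus_1_eq_1[OF _ _ Q_gt_0])
      show "((729 :: 'a alg_closure) ^ c) ^ Q j = 729 ^ c"
        by (simp add: frobenius_power frobenius_numeral)
      have "(729 :: 'a alg_closure) = 9 ^ 3" by simp
      then show "(729 :: 'a alg_closure) ^ c \<noteq> 0" using nine by (simp only: power_eq_0_iff) simp
    qed
    have "(\<gamma> n ^ M) ^ d = 1" using ord[of "M * d"] by (simp add: power_mult)
    moreover have "(\<gamma> n ^ M) ^ (Q (Suc k) - 1) = 1"
      unfolding M by (simp only: power_mult_distrib const \<gamma>_power_Q_minus_1 mult_1_left)
    ultimately have "(\<gamma> n ^ M) ^ gcd d (Q (Suc k) - 1) = 1" by (rule power_gcd_eq_1)
    moreover have "gcd d (Q (Suc k) - 1) dvd 3 * (Q k - 1)"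
    proof -
      have "Q (Suc k) - 1 = m * (3 * (Q k - 1))"
        unfolding Q_Suc cube_minus_1[OF Q_gt_0] m(1) by simp
      moreover have "coprime (gcd d (Q (Suc k) - 1)) m"
        using cop by (meson coprime_divisors dvd_refl gcd_dvd1)
      ultimately show ?thesis by (metis coprime_dvd_mult_right_iff gcd_dvd2)
    qed
    ultimately have "(\<gamma> n ^ M) ^ (3 * (Q k - 1)) = 1"
      by (elim dvdE) (simp only: power_mult power_one)
    then have "\<gamma> (Suc k) ^ (3 * (Q k - 1)) = 1"
      unfolding M power_mult_distrib mult.commute[of 3] using const[of k] by (simp add: power_mult)
    then show False using \<gamma>_cube_not_in_subfield by blast
  qed
  then have "gcd d m \<noteq> 1" by (simp add: coprime_iff_gcd_eq_1)
  then obtain l where "Factorial_Ring.prime l" "l dvd gcd d m" using prime_factor_nat by blast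
  then have l: "Factorial_Ring.prime l" "l dvd d" "l dvd m" by simp_all
  then have "l \<noteq> 3" using m(2) by auto
  then show ?thesis using l m(1) by auto
qed

text \<open>Being a noncube, \<open>\<gamma> n\<close> has an order with the full 3-part of the group order \<open>Q n - 1\<close>.\<close>
lemma three_power_dvd_order:
  assumes ord: "\<And>m. \<gamma> n ^ m = 1 \<longleftrightarrow> d dvd m"
  shows "3 ^ (multiplicity 3 (q - 1) + n) dvd d"
proof -
  have "d dvd Q n - 1" using ord \<gamma>_power_Q_minus_1 by blast
  then obtain t where t: "Q n - 1 = d * t" by blast
  have "\<not> 3 dvd t"
  proof
    assume "3 dvd t"
    then obtain r where "t = 3 * r" by blast
    then have "(Q n - 1) div 3 = d * r" unfolding t by simp
    then have "d dvd (Q n - 1) div 3" by simp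
    then show False using ord[of "(Q n - 1) div 3"] \<gamma>_power \<omega>(2) by simp
  qed
  then have "coprime (3 ^ (multiplicity 3 (q - 1) + n)) t"
    by (simp add: prime_imp_coprime coprime_power_left_iff)
  moreover have "3 ^ (multiplicity 3 (q - 1) + n) dvd d * t"
    unfolding t[symmetric] by (rule three_power_dvd_iterated_cube[OF q(2)])
  ultimately show ?thesis by (simp add: coprime_dvd_mult_left_iff)
qed

text \<open>The order is divisible by a power of 3 and, for each \<open>k < n\<close>, by a prime \<open>l k > 3\<^bsup>k+1\<^esup>\<close>. These
  factors are pairwise coprime: \<open>q\<close> has order \<open>3\<^bsup>k+1\<^esup>\<close> modulo \<open>l k\<close>, so the primes are distinct.\<close>
lemma order_lower_bound:
  assumes ord: "\<And>m. \<gamma> n ^ m = 1 \<longleftrightarrow> d dvd m" and n: "n \<ge> 1"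
  shows "3 ^ (multiplicity 3 (q - 1) + n + (\<Sum>k<n. Suc k)) < d"
proof -
  let ?v = "multiplicity 3 (q - 1) + n"
  obtain l where l: "\<And>k. k < n \<Longrightarrow> Factorial_Ring.prime (l k)" "\<And>k. k < n \<Longrightarrow> l k \<noteq> 3"
    "\<And>k. k < n \<Longrightarrow> l k dvd 1 + Q k + (Q k)\<^sup>2" "\<And>k. k < n \<Longrightarrow> l k dvd d"
    using order_prime_factor[OF ord] by metis
  have q_pos: "q \<ge> 1" using q(2) by (cases q) auto
  have ord_l: "Pocklington.ord (l k) q = 3 ^ Suc k" if "k < n" for k
    using that by (intro ord_eq_three_power l q_pos)
  have large: "3 ^ Suc k < l k" if "k < n" for k
  proof -
    have "coprime (l k) q" using ord_l[OF that] by (metis ord_def power_not_zero zero_neq_numeral)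
    then have "3 ^ Suc k dvd l k - 1"
      using order_divides_totient[of "l k" q] ord_l[OF that] l(1)[OF that] by (simp add: totient_prime)
    then show ?thesis using prime_gt_1_nat[OF l(1)[OF that]] by (auto dest!: dvd_imp_le)
  qed
  have dvd: "3 ^ ?v * (\<Prod>k<j. l k) dvd d" if "j \<le> n" for j
    using that
  proof (induction j)
    case 0
    show ?case using three_power_dvd_order[OF ord] by simp
  next
    case (Suc j)
    have "coprime (l j) (3 ^ ?v)"
      using l(1,2)[of j] Suc.prems by (simp add: primes_coprime)
    moreover have "coprime (l i) (l j)" if "i < j" for i
    proof (rule primes_coprime)
      show "l i \<noteq> l j" using ord_l[of i] ord_l[of j] that Suc.prems by auto
    qed (use l(1) that Suc.prems in auto)
    then have "coprime (\<Prod>k<j. l k) (l j)" by (intro prod_coprime_left) auto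
    ultimately have "coprime (3 ^ ?v * (\<Prod>k<j. l k)) (l j)" by (simp add: coprime_commute)
    moreover have "3 ^ ?v * (\<Prod>k<j. l k) dvd d" "l j dvd d" using Suc l(4)[of j] by auto
    ultimately have "(3 ^ ?v * (\<Prod>k<j. l k)) * l j dvd d" by (metis divides_mult)
    then show ?case by (simp add: mult.assoc)
  qed
  have "d > 0"
  proof (rule Nat.gr0I)
    assume "d = 0"
    then have "Q n - 1 = 0" using ord \<gamma>_power_Q_minus_1 by (metis dvd_0_left_iff)
    moreover have "Q n > 1" unfolding q(1) using CARD_finite_field_gt_1
      by (intro one_less_power) simp_all
    ultimately show False by simp
  qed
  have "(\<Prod>k<n. 3 ^ Suc k) < (\<Prod>k<n. l k)"
  proof (rule prod_mono_strict[of 0])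
    fix k assume "k \<in> {..<n}"
    then have "3 ^ Suc k < l k" by (intro large) simp
    then show "0 \<le> (3 :: nat) ^ Suc k \<and> 3 ^ Suc k \<le> l k" "0 < l k" by linarith+
  qed (use n large[of 0] in auto)
  then have "3 ^ (?v + (\<Sum>k<n. Suc k)) < 3 ^ ?v * (\<Prod>k<n. l k)"
    by (simp only: power_add power_sum) simp
  also have "\<dots> \<le> d" using dvd[of n] \<open>d > 0\<close> by (simp add: dvd_imp_le)
  finally show ?thesis .
qed

end

section \<open>Degree and order of the elements of the tower\<close>

theorem theorem2:
  fixes q :: nat and b :: "'a :: finite_field" and \<beta> \<gamma> :: "nat \<Rightarrow> 'a alg_closure"
  assumes q: "q = CARD('a)" "q mod 3 = 1" "q \<noteq> 4"
    and b: "\<not> (\<exists>y :: 'a. b ^ 3 - 1 = y ^ 3)"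
    and \<beta>_0: "\<beta> 0 = to_ac b"
    and \<beta>_root: "\<And>n. n \<ge> 1 \<Longrightarrow> g (\<beta> (n - 1)) (\<beta> n) = 0"
    and \<gamma>: "\<And>n. \<gamma> n = \<beta> n ^ 3 - 1"
  shows "\<forall>n\<ge>1.
    degree_over_ground (\<gamma> n) = 3 ^ n \<and>
    \<gamma> n \<in> carrier (extension_units (3 ^ n)) \<and>
    real (group.ord (extension_units (3 ^ n)) (\<gamma> n))
      > 3 powr (1 / 2 * real n ^ 2 + 3 / 2 * real n + real (multiplicity 3 (q - 1)))"
proof -
  have \<gamma>_0: "\<gamma> 0 = to_ac (b ^ 3 - 1)" by (simp add: \<gamma> \<beta>_0)
  interpret cubic_tower q \<beta> \<gamma> "\<gamma> 0 ^ ((q - 1) div 3)"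
  proof
    show "\<beta> 0 ^ q = \<beta> 0"
      using ground_field_eq[where ?'a = 'a] by (auto simp: \<beta>_0 q(1))
    show "g (\<beta> n) (\<beta> (Suc n)) = 0" for n using \<beta>_root[of "Suc n"] by simp
    show "\<gamma> 0 \<noteq> 0"
    proof
      assume "\<gamma> 0 = 0"
      then have "b ^ 3 - 1 = 0" unfolding \<gamma>_0 by (simp only: to_ac_eq_0_iff)
      then have "b ^ 3 - 1 = 0 ^ 3" by simp
      then show False using b by blast
    qed
    show "\<gamma> 0 ^ ((q - 1) div 3) \<noteq> 1"
    proof
      assume "\<gamma> 0 ^ ((q - 1) div 3) = 1"
      then have "to_ac ((b ^ 3 - 1) ^ ((q - 1) div 3)) = to_ac 1" unfolding \<gamma>_0 by simp
      then have "(b ^ 3 - 1) ^ ((q - 1) div 3) = 1" by (simp only: to_ac_eq_iff)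
      then show False using cube_if_power_eq_1[of "b ^ 3 - 1"] b q by simp
    qed
  qed (use q \<gamma> in auto)
  show ?thesis
  proof (intro allI impI conjI)
    fix n :: nat assume n: "n \<ge> 1"
    show "degree_over_ground (\<gamma> n) = 3 ^ n" by (rule degree_\<gamma>[OF n])
    have pos: "(3 :: nat) ^ n > 0" by simp
    note units = extension_units_props[OF pos \<gamma>_fixed[unfolded q(1)] \<gamma>_nz]
    show "\<gamma> n \<in> carrier (extension_units (3 ^ n))" by (rule units(1))
    have sum: "real (\<Sum>k<n. Suc k) = real n * (real n + 1) / 2" for n
      by (induction n) (auto simp: field_simps)
    have "3 powr (1 / 2 * real n ^ 2 + 3 / 2 * real n + real (multiplicity 3 (q - 1))) =
        3 powr real (multiplicity 3 (q - 1) + n + (\<Sum>k<n. Suc k))"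
      unfolding of_nat_add sum by (rule arg_cong[where f = "(powr) 3"]) (simp add: field_simps power2_eq_square)
    also have "\<dots> = real (3 ^ (multiplicity 3 (q - 1) + n + (\<Sum>k<n. Suc k)))"
      by (subst powr_realpow) simp_all
    also have "\<dots> < real (group.ord (extension_units (3 ^ n)) (\<gamma> n))"
      using order_lower_bound[OF units(2) n] by (simp only: of_nat_less_iff)
    finally show "real (group.ord (extension_units (3 ^ n)) (\<gamma> n))
      > 3 powr (1 / 2 * real n ^ 2 + 3 / 2 * real n + real (multiplicity 3 (q - 1)))" .
  qed
qed

end
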